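(* Let $\Delta=\{z\in\mathbb{C}:|z|<1\}$. Suppose $[\mu]_Z\in Z(\Delta)$ and $\lambda>\|[\mu]_Z\|$. Then $[\mu]_Z$ contains infinitely many weakly non-decreasable dilatations $\nu$ with $\|\nu\|_\infty\le\lambda$.
   Context: $Bel(\Delta)$ is the Banach space of Beltrami differentials $\mu=\mu(z)\,d\bar z/dz$ on $\Delta$ with finite $L^\infty$-norm (i.e. complex-valued $\mu\in L^\infty(\Delta)$; elements are identified when equal a.e.). The norm is not required to be less than $1$. $Q(\Delta)$ is the Banach space of holomorphic functions (quadratic differentials) $\varphi$ on $\Delta$ with $\|\varphi\|=\iint_\Delta|\varphi(z)|\,dxdy<\infty$. Two elements $\mu,\nu\in Bel(\Delta)$ are infinitesimally Teichmüller equivalent if $\iint_\Delta(\mu-\nu)\varphi\,dxdy=0$ for all $\varphi\in Q(\Delta)$; $[\mu]_Z$ denotes the equivalence class of $\mu$, and $Z(\Delta)$ is the quotient space, with norm $\|[\mu]_Z\|=\inf\{\|\nu\|_\infty:\nu\in[\mu]_Z\}$. A Beltrami differential (also called a dilatation) $\mu$ is strongly decreasable in $[\mu]_Z$ if there exists $\nu\in[\mu]_Z$ such that (A) $|\nu(z)|\le|\mu(z)|$ for almost all $z\in\Delta$, and (B) there exist a (nonempty) domain $G\subset\Delta$ and $\delta>0$ with $|\nu(z)|\le|\mu(z)|-\delta$ for almost all $z\in G$. Otherwise $\mu$ is weakly non-decreasable. *)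

theory Defs
  imports "HOL-Complex_Analysis.Complex_Analysis" "HOL-Probability.Essential_Supremum"
begin

abbreviation disc :: "complex set" ("\<Delta>") where
  "\<Delta> \<equiv> ball 0 1"

abbreviation disc_measure :: "complex measure" where
  "disc_measure \<equiv> lebesgue_on \<Delta>"

text \<open>
  Beltrami differentials are represented by functions on all of \<open>complex\<close>, of which only the
  restriction to \<open>\<Delta>\<close> matters. Elements of the Banach space \<open>Bel(\<Delta>)\<close> are the equivalence
  classes of such functions under equality almost everywhere, see \<open>ae_rel\<close>.
\<close>

definition bel_esssup :: "(complex \<Rightarrow> complex) \<Rightarrow> ereal" where
  "bel_esssup \<mu> = esssup disc_measure (\<lambda>z. ereal (cmod (\<mu> z)))"

definition Bel :: "(complex \<Rightarrow> complex) set" where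
  "Bel = {\<mu>. \<mu> \<in> borel_measurable disc_measure \<and> bel_esssup \<mu> < \<infinity>}"

definition bel_norm :: "(complex \<Rightarrow> complex) \<Rightarrow> real" where
  "bel_norm \<mu> = real_of_ereal (bel_esssup \<mu>)"

definition ae_rel :: "((complex \<Rightarrow> complex) \<times> (complex \<Rightarrow> complex)) set" where
  "ae_rel = {(\<mu>, \<nu>). \<mu> \<in> Bel \<and> \<nu> \<in> Bel \<and> (AE z in disc_measure. \<mu> z = \<nu> z)}"

definition quad_diffs :: "(complex \<Rightarrow> complex) set" where
  "quad_diffs = {\<phi>. \<phi> holomorphic_on \<Delta> \<and> integrable disc_measure (\<lambda>z. cmod (\<phi> z))}"

definition Z_rel :: "((complex \<Rightarrow> complex) \<times> (complex \<Rightarrow> complex)) set" where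
  "Z_rel = {(\<mu>, \<nu>). \<mu> \<in> Bel \<and> \<nu> \<in> Bel \<and>
     (\<forall>\<phi>\<in>quad_diffs. (LINT z|disc_measure. (\<mu> z - \<nu> z) * \<phi> z) = 0)}"

definition Z_class :: "(complex \<Rightarrow> complex) \<Rightarrow> (complex \<Rightarrow> complex) set" where
  "Z_class \<mu> = Z_rel `` {\<mu>}"

definition Z_norm :: "(complex \<Rightarrow> complex) set \<Rightarrow> real" where
  "Z_norm C = (INF \<nu>\<in>C. bel_norm \<nu>)"

definition strongly_decreasable :: "(complex \<Rightarrow> complex) \<Rightarrow> bool" where
  "strongly_decreasable \<mu> \<longleftrightarrow>
     (\<exists>\<nu>\<in>Z_class \<mu>.
        (AE z in disc_measure. cmod (\<nu> z) \<le> cmod (\<mu> z)) \<and>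
        (\<exists>G \<delta>. open G \<and> connected G \<and> G \<noteq> {} \<and> G \<subseteq> \<Delta> \<and> \<delta> > 0 \<and>
           (AE z in lebesgue_on G. cmod (\<nu> z) \<le> cmod (\<mu> z) - \<delta>)))"

definition weakly_non_decreasable :: "(complex \<Rightarrow> complex) \<Rightarrow> bool" where
  "weakly_non_decreasable \<mu> \<longleftrightarrow> \<not> strongly_decreasable \<mu>"

end

theory Submission
  imports Defs
begin

text \<open>
  A differential vanishing on an open dense set is weakly non-decreasable, because nothing can be
  smaller by \<open>\<delta> > 0\<close> on any domain. So it suffices to move a representative of norm below
  \<open>\<lambda>\<close> off an open dense set \<open>E\<close> inside its class, at the cost of a factor close to 1. By a
  reproducing formula \<open>\<phi>(w) = \<integral> K(z,w) \<phi>(z) dz\<close> with \<open>|K(z,w)| \<le> k(w)\<close>, the mass on \<open>E\<close>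
  is swept over the disc by an operator of norm at most \<open>\<integral>\<^sub>E k\<close>, which is made small, and the
  sweeping is iterated. Prescribing different small constants on a further set \<open>F\<close> of
  positive measure, disjoint from \<open>E\<close>, produces infinitely many such differentials.
\<close>

section \<open>A reproducing formula whose kernel is bounded uniformly in the integration
  variable\<close>

text \<open>Parametrising u = c + R cis t in Cauchy's integral formula gives du = i R cis t dt, and
  the factor i cancels. The point w may be anywhere inside the circle, which matters because the
  centre c will vary while w stays fixed.\<close>

lemma Cauchy_circle_average:
  fixes \<phi> :: "complex \<Rightarrow> complex"
  assumes "\<phi> holomorphic_on cball c R" and "dist w c < R"
  shows "(LINT t|restrict_space lborel {0..2*pi}.
           \<phi> (c + of_real R * cis t) * (of_real R * cis t / (c + of_real R * cis t - w)))
         = 2 * of_real pi * \<phi> w"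
proof -
  define f where "f = (\<lambda>t. \<phi> (c + of_real R * cis t) * (of_real R * cis t / (c + of_real R * cis t - w)))"
  have "R > 0" using assms(2) by (smt (verit) zero_le_dist)
  have ci: "((\<lambda>u. \<phi> u / (u - w)) has_contour_integral (2 * of_real pi * \<i> * \<phi> w)) (circlepath c R)"
    using assms by (intro Cauchy_integral_circlepath)
      (auto intro: holomorphic_on_imp_continuous_on holomorphic_on_subset simp: dist_norm)
  have "((\<lambda>t. \<phi> (c + of_real R * cis t) / (c + of_real R * cis t - w) * of_real R * \<i> * cis t)
      has_integral 2 * of_real pi * \<i> * \<phi> w) {0..2*pi}"
    using ci unfolding circlepath_def by (subst (asm) has_contour_integral_part_circlepath_iff) auto
  from has_integral_mult_right[OF this, of "-\<i>"]
  have hi: "(f has_integral 2 * of_real pi * \<phi> w) {0..2*pi}"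
    unfolding f_def by (simp add: field_simps)
  have ne: "c + of_real R * cis t \<noteq> w" for t
  proof
    assume *: "c + of_real R * cis t = w"
    have "dist w c = R" unfolding *[symmetric] using \<open>R > 0\<close> by (simp add: dist_norm norm_mult)
    then show False using assms(2) by simp
  qed
  have "continuous_on {0..2*pi} (\<lambda>t. \<phi> (c + of_real R * cis t))"
    by (rule continuous_on_compose2[OF holomorphic_on_imp_continuous_on[OF assms(1)]])
       (use \<open>R > 0\<close> in \<open>auto intro!: continuous_intros simp: dist_norm norm_mult\<close>)
  then have "continuous_on {0..2*pi} f"
    unfolding f_def using ne by (intro continuous_intros) auto
  then have "set_integrable lborel {0..2*pi} f" by (rule borel_integrable_atLeastAtMost')
  from set_borel_integral_eq_integral(2)[OF this] hi
  have "(LINT t:{0..2*pi}|lborel. f t) = 2 * of_real pi * \<phi> w" by (simp add: integral_unique)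
  then show ?thesis
    by (simp add: integral_restrict_space set_lebesgue_integral_def f_def)
qed

text \<open>The displacement u(t) from the centre to the point at angle t of a circle whose radius
  is half the distance from w to the unit circle.\<close>

definition circle_pt :: "complex \<Rightarrow> real \<Rightarrow> complex" where
  "circle_pt w t = of_real ((1 - cmod w) / 2) * cis t"

text \<open>The Cauchy factor, expressed through the point z on the circle instead of the centre c =
  z - u(t): the condition says that c lies within (1 - |w|) / 4 of w, and z - w = c + u(t) -
  w.\<close>

definition averaging_kernel :: "complex \<Rightarrow> complex \<Rightarrow> real \<Rightarrow> complex" where
  "averaging_kernel z w t =
     (if cmod (z - circle_pt w t - w) < (1 - cmod w) / 4 then circle_pt w t / (z - w) else 0)"

text \<open>The constant is the reciprocal of 2 pi times pi r^2 with r = (1 - |w|) / 4: the length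
  of the angle interval times the area of the disc of centres.\<close>

definition repro_kernel :: "complex \<Rightarrow> complex \<Rightarrow> complex" where
  "repro_kernel z w = of_real (8 / (pi\<^sup>2 * (1 - cmod w)\<^sup>2)) *
     (LINT t|restrict_space lborel {0..2*pi}. averaging_kernel z w t)"

text \<open>The constant of \<open>repro_kernel\<close> times the bound 2 of the averaging kernel
  times the interval length 2 pi.\<close>

definition kernel_bound :: "complex \<Rightarrow> real" where
  "kernel_bound w = 32 / (pi * (1 - cmod w)\<^sup>2)"

lemma norm_circle_pt: "w \<in> \<Delta> \<Longrightarrow> cmod (circle_pt w t) = (1 - cmod w) / 2"
  unfolding circle_pt_def norm_mult norm_of_real norm_cis by simp

text \<open>Where the kernel does not vanish, the numerator has modulus 2r and the denominator more
  than 2r - r, with r = (1 - |w|) / 4.\<close>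

lemma norm_averaging_kernel_le:
  assumes "w \<in> \<Delta>"
  shows "cmod (averaging_kernel z w t) \<le> 2"
proof (cases "cmod (z - circle_pt w t - w) < (1 - cmod w) / 4")
  case True
  have "cmod (circle_pt w t) \<le> cmod (z - w) + cmod (z - circle_pt w t - w)"
    using norm_triangle_ineq4[of "z - w" "z - circle_pt w t - w"] by simp
  with True norm_circle_pt[OF assms, of t] assms show ?thesis
    by (simp add: averaging_kernel_def norm_divide divide_le_eq norm_minus_commute)
qed (simp add: averaging_kernel_def)

lemma averaging_kernel_measurable [measurable (raw)]:
  assumes [measurable]: "f \<in> borel_measurable M" "g \<in> borel_measurable M" "h \<in> borel_measurable M"
  shows "(\<lambda>x. averaging_kernel (f x) (g x) (h x)) \<in> borel_measurable M"
proof -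
  have [measurable]: "cis \<in> borel_measurable borel"
    by (intro borel_measurable_continuous_onI continuous_intros)
  show ?thesis
    unfolding averaging_kernel_def circle_pt_def by measurable
qed

lemma finite_measure_interval: "finite_measure (restrict_space lborel {0..2*pi::real})"
  by (rule finite_measureI) (simp add: emeasure_restrict_space space_restrict_space)

lemma repro_kernel_measurable:
  "(\<lambda>x. repro_kernel (fst x) (snd x)) \<in> borel_measurable borel"
proof -
  interpret N: finite_measure "restrict_space lborel {0..2*pi::real}"
    by (rule finite_measure_interval)
  let ?P = "(borel :: (complex \<times> complex) measure) \<Otimes>\<^sub>M restrict_space lborel {0..2*pi::real}"
  have id: "(\<lambda>t. t) \<in> borel_measurable (restrict_space lborel {0..2*pi::real})"
    by (rule measurable_restrict_space1) simp
  have snd: "snd \<in> borel_measurable ?P"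
    using measurable_compose[OF measurable_snd id] .
  have fst: "(\<lambda>p. fst (fst p)) \<in> borel_measurable ?P" "(\<lambda>p. snd (fst p)) \<in> borel_measurable ?P"
    by (rule measurable_compose[OF measurable_fst],
        intro borel_measurable_continuous_onI continuous_intros)+
  have [measurable]: "(\<lambda>x. LINT t|restrict_space lborel {0..2*pi}. averaging_kernel (fst x) (snd x) t)
      \<in> borel_measurable borel"
    unfolding split_beta'
    by (rule N.borel_measurable_lebesgue_integral)
      (unfold split_beta', rule averaging_kernel_measurable[OF fst snd])
  have [measurable]: "(\<lambda>x::complex \<times> complex. cmod (snd x)) \<in> borel_measurable borel"
    by (intro borel_measurable_continuous_onI continuous_intros)
  show ?thesis
    unfolding repro_kernel_def by measurable
qed

lemma norm_repro_kernel_le: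
  assumes "w \<in> \<Delta>"
  shows "cmod (repro_kernel z w) \<le> kernel_bound w"
proof -
  interpret N: finite_measure "restrict_space lborel {0..2*pi::real}"
    by (rule finite_measure_interval)
  have "cmod (LINT t|restrict_space lborel {0..2*pi}. averaging_kernel z w t) \<le> 
    (LINT t|restrict_space lborel {0..2*pi}. 2)"
  proof (rule order_trans[OF integral_norm_bound integral_mono])
    show "integrable (restrict_space lborel {0..2*pi}) (\<lambda>t. cmod (averaging_kernel z w t))"
      by (rule N.integrable_const_bound[where B = 2])
         (simp_all add: norm_averaging_kernel_le[OF assms] averaging_kernel_measurable measurable_restrict_space1)
  qed (use norm_averaging_kernel_le[OF assms] in auto)
  also have "\<dots> = 4 * pi" 
    by (simp add: measure_restrict_space space_restrict_space)
  finally have "cmod (repro_kernel z w) \<le> 8 / (pi\<^sup>2 * (1 - cmod w)\<^sup>2) * (4 * pi)"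
    unfolding repro_kernel_def norm_mult norm_of_real by (intro mult_mono) auto
  also have "\<dots> = kernel_bound w"
    by (simp add: kernel_bound_def power2_eq_square)
  finally show ?thesis .
qed

text \<open>Translation and Fubini are carried out over \<open>lborel\<close>; a Borel zero
  extension makes the passage from the completed measure harmless.\<close>

lemma integral_disc_measure:
  fixes f :: "complex \<Rightarrow> complex"
  assumes "(\<lambda>z. indicator \<Delta> z *\<^sub>R f z) \<in> borel_measurable borel"
  shows "(LINT z|disc_measure. f z) = (LINT z|lborel. indicator \<Delta> z *\<^sub>R f z)"
  using assms by (simp add: integral_restrict_space integral_completion)

text \<open>Averaging Cauchy's formula over circles whose centre varies in a disc needs only
  translation invariance of Lebesgue measure, and gives a bounded kernel.\<close>

lemma repro_kernel_reproduces:
  fixes \<phi> :: "complex \<Rightarrow> complex"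
  assumes hol: "\<phi> holomorphic_on \<Delta>" and w: "w \<in> \<Delta>"
  shows "(LINT z|disc_measure. repro_kernel z w * \<phi> z) = \<phi> w"
proof -
  let ?N = "restrict_space lborel {0..2*pi::real}"
  interpret N: finite_measure ?N by (rule finite_measure_interval)
  interpret P: pair_sigma_finite lborel ?N ..
  \<comment> \<open>Circles of radius 2r with centres within r of w stay in the closed disc of
    radius 3r about w, which lies in \<Delta> because w has distance 4r from the unit
    circle.\<close>
  define r where "r = (1 - cmod w) / 4"
  \<comment> \<open>The extension by zero lets z range over the whole plane, on which translations
    act.\<close>
  define \<psi> where "\<psi> = (\<lambda>z. indicator \<Delta> z *\<^sub>R \<phi> z)"
  define u where "u = circle_pt w"
  define G where "G = (\<lambda>z t. averaging_kernel z w t * \<psi> z)"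
  have r: "r > 0" "cmod w + 4 * r = 1" using w by (auto simp: r_def field_simps)
  have sub: "cball w (3 * r) \<subseteq> \<Delta>"
  proof
    fix z assume "z \<in> cball w (3 * r)"
    then have "cmod (z - w) \<le> 3 * r" by (simp add: dist_norm norm_minus_commute)
    then show "z \<in> \<Delta>" using norm_triangle_sub[of z w] r by simp
  qed
  have nu: "cmod (u t) = 2 * r" for t using norm_circle_pt[OF w, of t] by (simp add: u_def r_def field_simps)
  have u_cis: "u t = of_real (2 * r) * cis t" for t by (simp add: u_def circle_pt_def r_def field_simps)
  have \<psi>_meas [measurable]: "\<psi> \<in> borel_measurable borel"
    unfolding \<psi>_def by (intro borel_measurable_continuous_on_indicator holomorphic_on_imp_continuous_on hol) simp
  have cont: "continuous_on (cball w (3 * r)) \<phi>"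
    using hol sub by (meson continuous_on_subset holomorphic_on_imp_continuous_on)
  from compact_imp_bounded[OF compact_continuous_image[OF cont compact_cball]]
  obtain B where B: "\<And>z. z \<in> cball w (3 * r) \<Longrightarrow> cmod (\<phi> z) \<le> B"
    unfolding bounded_iff by blast
  have "B \<ge> 0" using order_trans[OF norm_ge_zero B[of w]] r by simp
  have near: "cmod (z - w) \<le> 3 * r" if "cmod (z - u t - w) < r" for z t
    using that norm_triangle_ineq[of "z - u t - w" "u t"] nu[of t] by simp
  have G_bound: "cmod (G z t) \<le> 2 * B" for z t
  proof (cases "cmod (z - u t - w) < r")
    case True
    then have "z \<in> cball w (3 * r)" using near[OF True] by (simp add: dist_norm norm_minus_commute)
    then have "cmod (\<psi> z) \<le> B" using B by (auto simp: \<psi>_def indicator_def \<open>B \<ge> 0\<close>)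
    then show ?thesis
      unfolding G_def norm_mult using norm_averaging_kernel_le[OF w] by (intro mult_mono) auto
  next
    case False
    then show ?thesis using \<open>B \<ge> 0\<close> by (simp add: G_def averaging_kernel_def u_def r_def)
  qed
  have G_supp: "G z t = 0" if "z \<notin> cball w (3 * r)" for z t
    using that near[of z t] by (auto simp: G_def averaging_kernel_def u_def r_def dist_norm norm_minus_commute)
  have idN: "(\<lambda>t. t) \<in> borel_measurable ?N"
    by (rule measurable_restrict_space1) simp
  have sndN: "snd \<in> borel_measurable (lborel \<Otimes>\<^sub>M ?N)"
    using measurable_compose[OF measurable_snd idN] .
  have fstN: "fst \<in> borel_measurable (lborel \<Otimes>\<^sub>M ?N)"
    by (rule measurable_compose[OF measurable_fst]) simp
  have u_meas: "u \<in> borel_measurable borel"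
    unfolding u_def circle_pt_def by (intro borel_measurable_continuous_onI continuous_intros)
  have uN: "(\<lambda>x. u (snd x)) \<in> borel_measurable (lborel \<Otimes>\<^sub>M ?N)"
    by (rule measurable_compose[OF sndN u_meas])
  have G_meas: "(\<lambda>x. G (fst x + a x) (snd x)) \<in> borel_measurable (lborel \<Otimes>\<^sub>M ?N)"
    if "a \<in> borel_measurable (lborel \<Otimes>\<^sub>M ?N)" for a
    unfolding G_def
    by (intro borel_measurable_times averaging_kernel_measurable borel_measurable_add fstN sndN that
        measurable_compose[OF _ \<psi>_meas]) auto
  \<comment> \<open>Both G and its translate are bounded by 2B and vanish when the first variable
    leaves a bounded set, so one criterion serves both uses of Fubini.\<close>
  have int: "integrable (lborel \<Otimes>\<^sub>M ?N) (\<lambda>x. H (fst x) (snd x))"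
    if A: "bounded A" "A \<in> sets borel"
      and H: "(\<lambda>x. H (fst x) (snd x)) \<in> borel_measurable (lborel \<Otimes>\<^sub>M ?N)"
        "\<And>z t. cmod (H z t) \<le> 2 * B" "\<And>z t. z \<notin> A \<Longrightarrow> H z t = 0"
    for A :: "complex set" and H :: "complex \<Rightarrow> real \<Rightarrow> complex"
  proof (rule integrableI_bounded_set[OF _ H(1), where A = "A \<times> space ?N" and B = "2 * B"])
    show "A \<times> space ?N \<in> sets (lborel \<Otimes>\<^sub>M ?N)"
      by (rule pair_measureI) (simp_all only: A sets_lborel sets.top)
    have "emeasure (lborel \<Otimes>\<^sub>M ?N) (A \<times> space ?N) = emeasure lborel A * emeasure ?N (space ?N)"
      by (rule N.emeasure_pair_measure_Times) (simp_all only: A sets_lborel sets.top)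
    then show "emeasure (lborel \<Otimes>\<^sub>M ?N) (A \<times> space ?N) < \<infinity>"
      using emeasure_bounded_finite[OF A(1)] N.emeasure_finite[of "space ?N"]
      by (simp only: ennreal_mult_less_top less_top infinity_ennreal_def simp_thms)
    show "AE x in lborel \<Otimes>\<^sub>M ?N. x \<in> A \<times> space ?N \<longrightarrow> cmod (H (fst x) (snd x)) \<le> 2 * B"
      using H(2) by simp
    show "AE x in lborel \<Otimes>\<^sub>M ?N. x \<notin> A \<times> space ?N \<longrightarrow> H (fst x) (snd x) = 0"
    proof (rule AE_I2, rule impI)
      fix x assume "x \<in> space (lborel \<Otimes>\<^sub>M ?N)" "x \<notin> A \<times> space ?N"
      then have "fst x \<notin> A" by (auto simp: space_pair_measure)
      then show "H (fst x) (snd x) = 0" by (rule H(3))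
    qed
  qed
  have G_int: "integrable (lborel \<Otimes>\<^sub>M ?N) (case_prod G)"
    unfolding split_beta'
    by (rule int[of "cball w (3 * r)"]) (use G_meas[of "\<lambda>_. 0"] G_bound G_supp in auto)
  have F_supp: "G (u t + c) t = 0" if "c \<notin> ball w r" for c t
    using that by (auto simp: G_def averaging_kernel_def u_def r_def dist_norm norm_minus_commute)
  have F_int: "integrable (lborel \<Otimes>\<^sub>M ?N) (\<lambda>(c, t). G (u t + c) t)"
    unfolding split_beta'
    by (rule int[of "ball w r"]) (use G_meas[OF uN] G_bound F_supp in \<open>simp_all add: add.commute\<close>)
  have F_inner: "(LINT t|?N. G (u t + c) t) = indicator (ball w r) c *\<^sub>R (2 * of_real pi * \<phi> w)" for c
  proof (cases "c \<in> ball w r")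
    case True
    have cb: "cball c (2 * r) \<subseteq> \<Delta>"
    proof (rule order_trans[OF _ sub], rule subsetI)
      fix z assume "z \<in> cball c (2 * r)"
      then show "z \<in> cball w (3 * r)" using True dist_triangle[of w z c] by simp
    qed
    have "G (u t + c) t = \<phi> (c + of_real (2 * r) * cis t) *
            (of_real (2 * r) * cis t / (c + of_real (2 * r) * cis t - w))" for t
    proof -
      have "c + u t \<in> cball c (2 * r)" by (simp add: dist_norm nu)
      then have "c + u t \<in> \<Delta>" using cb by blast
      moreover have "cmod (c - w) < (1 - cmod w) / 4"
        using True by (simp add: r_def dist_norm norm_minus_commute)
      ultimately show ?thesis
        unfolding u_cis[symmetric] G_def \<psi>_def averaging_kernel_def u_def
        by (simp add: add.commute)
    qed
    then have "(LINT t|?N. G (u t + c) t) = 2 * of_real pi * \<phi> w"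
      using Cauchy_circle_average[of \<phi> c "2 * r" w] hol cb True r
      by (simp add: holomorphic_on_subset)
    with True show ?thesis by simp
  qed (simp add: F_supp)
  have shift: "(LINT z|lborel. G z t) = (LINT c|lborel. G (u t + c) t)" for t
  proof -
    have "(\<lambda>z. G z t) \<in> borel_measurable borel"
      unfolding G_def by measurable
    then show ?thesis
      by (subst lborel_distr_plus[of "u t", symmetric]) (simp add: integral_distr)
  qed
  \<comment> \<open>Integrating over z first, with t fixed, allows the substitution z = u(t) + c.
    Exchanging back leaves, for each centre c within r of w, a full Cauchy average over the circle
    of radius 2r about c.\<close>
  have "(LINT z|lborel. LINT t|?N. G z t) = (LINT t|?N. LINT z|lborel. G z t)"
    by (rule P.Fubini_integral[OF G_int, symmetric])
  also have "\<dots> = (LINT t|?N. LINT c|lborel. G (u t + c) t)" by (simp add: shift)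
  also have "\<dots> = (LINT c|lborel. LINT t|?N. G (u t + c) t)"
    by (rule P.Fubini_integral[OF F_int])
  also have "\<dots> = (LINT c|lborel. indicator (ball w r) c *\<^sub>R (2 * of_real pi * \<phi> w))"
    by (simp only: F_inner)
  also have "\<dots> = measure lborel (ball w r) *\<^sub>R (2 * of_real pi * \<phi> w)"
    by (rule has_bochner_integral_integral_eq, rule has_bochner_integral_indicator)
       (use emeasure_bounded_finite[of "ball w r"] in auto)
  also have "measure lborel (ball w r) = pi * r\<^sup>2"
    using r content_ball[of r w] by (simp add: unit_ball_vol_2)
  finally have avg: "(LINT z|lborel. LINT t|?N. G z t) = of_real (2 * pi\<^sup>2 * r\<^sup>2) * \<phi> w"
    by (simp add: scaleR_conv_of_real power2_eq_square)
  define C where "C = 8 / (pi\<^sup>2 * (1 - cmod w)\<^sup>2)"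
  have C: "C * (2 * pi\<^sup>2 * r\<^sup>2) = 1"
    using w by (simp add: C_def r_def power_divide)
  have ind: "indicator \<Delta> z *\<^sub>R (repro_kernel z w * \<phi> z) = repro_kernel z w * \<psi> z" for z
    by (simp add: \<psi>_def)
  have kern: "repro_kernel z w * \<psi> z = of_real C * (LINT t|?N. G z t)" for z
    unfolding repro_kernel_def G_def C_def by (simp only: integral_mult_left_zero mult.assoc)
  have "(\<lambda>z. repro_kernel z w) \<in> borel_measurable borel"
    by (rule measurable_compose[OF _ repro_kernel_measurable, of "\<lambda>z. (z, w)", simplified])
       (intro borel_measurable_continuous_onI continuous_intros)
  then have "(\<lambda>z. repro_kernel z w * \<psi> z) \<in> borel_measurable borel" by simp
  then have "(LINT z|disc_measure. repro_kernel z w * \<phi> z) = (LINT z|lborel. repro_kernel z w * \<psi> z)"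
    using integral_disc_measure[of "\<lambda>z. repro_kernel z w * \<phi> z"] unfolding ind by blast
  also have "\<dots> = of_real C * (LINT z|lborel. LINT t|?N. G z t)"
    unfolding kern by (rule integral_mult_right_zero)
  also have "\<dots> = of_real (C * (2 * pi\<^sup>2 * r\<^sup>2)) * \<phi> w" unfolding avg by simp
  finally show ?thesis using C by simp
qed

section \<open>The sweeping operator and its Neumann series\<close>

text \<open>A form of balayage: the mass of g at a point w of E is replaced by the density
  \<open>repro_kernel z w\<close> in z, which has the same pairing with every element of
  \<open>quad_diffs\<close>.\<close>

definition sweep :: "complex set \<Rightarrow> (complex \<Rightarrow> complex) \<Rightarrow> complex \<Rightarrow> complex" where
  "sweep E g z = (LINT w|disc_measure. indicator E w *\<^sub>R (g w * repro_kernel z w))"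

lemma finite_measure_disc: "finite_measure disc_measure"
  by (rule finite_measure_lebesgue_on) simp

lemma ident_disc_measurable: "(\<lambda>z. z) \<in> borel_measurable disc_measure"
  by (rule measurable_restrict_space1) (simp add: measurable_completion)

lemma borel_disc_measurable: "E \<in> sets borel \<Longrightarrow> E \<subseteq> \<Delta> \<Longrightarrow> E \<in> sets disc_measure"
  by (simp add: sets_restrict_space_iff)

lemma kernel_bound_nonneg: "0 \<le> kernel_bound w"
  by (simp add: kernel_bound_def)

lemma quad_diffs_measurable: "\<phi> \<in> quad_diffs \<Longrightarrow> \<phi> \<in> borel_measurable disc_measure"
  unfolding quad_diffs_def
  by (auto intro: continuous_imp_measurable_on_sets_lebesgue holomorphic_on_imp_continuous_on)

lemma integrable_mult_quad_diff:
  assumes "f \<in> borel_measurable disc_measure" "\<phi> \<in> quad_diffs" 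
    and "AE z in disc_measure. cmod (f z) \<le> B"
  shows "integrable disc_measure (\<lambda>z. f z * \<phi> z)"
proof (rule Bochner_Integration.integrable_bound)
  show "integrable disc_measure (\<lambda>z. B * cmod (\<phi> z))"
    using assms(2) by (simp add: quad_diffs_def)
  show "(\<lambda>z. f z * \<phi> z) \<in> borel_measurable disc_measure"
    using assms(1) quad_diffs_measurable[OF assms(2)] by (rule borel_measurable_times)
  show "AE z in disc_measure. cmod (f z * \<phi> z) \<le> norm (B * cmod (\<phi> z))"
    using assms(3)
  proof eventually_elim
    case (elim z)
    then have "cmod (f z) * cmod (\<phi> z) \<le> B * cmod (\<phi> z)" by (rule mult_right_mono) simp
    then show ?case unfolding norm_mult real_norm_def by linarith
  qed
qed

lemma (in pair_sigma_finite) integrable_times: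
  fixes a :: "'a \<Rightarrow> real" and b :: "'b \<Rightarrow> real"
  assumes a: "integrable M1 a" and b: "integrable M2 b"
  shows "integrable (M1 \<Otimes>\<^sub>M M2) (\<lambda>x. a (fst x) * b (snd x))"
proof (rule Fubini_integrable)
  have [measurable]: "a \<in> borel_measurable M1" "b \<in> borel_measurable M2"
    using a b by auto
  show "(\<lambda>x. a (fst x) * b (snd x)) \<in> borel_measurable (M1 \<Otimes>\<^sub>M M2)"
    by measurable
  show "integrable M1 (\<lambda>x. \<integral>y. norm (a (fst (x, y)) * b (snd (x, y))) \<partial>M2)"
    using a b by (simp add: abs_mult)
  show "AE x in M1. integrable M2 (\<lambda>y. a (fst (x, y)) * b (snd (x, y)))"
    using b by simp
qed

lemma sweep_kernel_measurable:
  assumes E: "E \<in> sets borel" "E \<subseteq> \<Delta>" and g: "g \<in> borel_measurable disc_measure"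
  shows "(\<lambda>p. indicator E (snd p) *\<^sub>R (g (snd p) * repro_kernel (fst p) (snd p)))
    \<in> borel_measurable (disc_measure \<Otimes>\<^sub>M disc_measure)"
proof -
  have s: "snd \<in> borel_measurable (disc_measure \<Otimes>\<^sub>M disc_measure)"
    using measurable_compose[OF measurable_snd ident_disc_measurable] .
  have f: "fst \<in> borel_measurable (disc_measure \<Otimes>\<^sub>M disc_measure)"
    using measurable_compose[OF measurable_fst ident_disc_measurable] .
  have "(\<lambda>p. (fst p, snd p)) \<in> borel_measurable (disc_measure \<Otimes>\<^sub>M disc_measure)"
    unfolding borel_prod[symmetric] by (rule measurable_Pair[OF f s])
  from measurable_compose[OF this repro_kernel_measurable]
  have K: "(\<lambda>p. repro_kernel (fst p) (snd p)) \<in> borel_measurable (disc_measure \<Otimes>\<^sub>M disc_measure)"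
    by simp
  have G: "(\<lambda>p. g (snd p)) \<in> borel_measurable (disc_measure \<Otimes>\<^sub>M disc_measure)"
    by (rule measurable_compose[OF measurable_snd g])
  have I: "(\<lambda>p. indicator E (snd p) :: real) \<in> borel_measurable (disc_measure \<Otimes>\<^sub>M disc_measure)"
    by (rule measurable_compose[OF s]) (use E in simp)
  show ?thesis by (intro borel_measurable_scaleR borel_measurable_times I G K)
qed

lemma sweep_measurable:
  assumes "E \<in> sets borel" "E \<subseteq> \<Delta>" "g \<in> borel_measurable disc_measure"
  shows "sweep E g \<in> borel_measurable disc_measure"
proof -
  interpret finite_measure disc_measure by (rule finite_measure_disc)
  show ?thesis unfolding sweep_def[abs_def]
    by (rule borel_measurable_lebesgue_integral)
       (use sweep_kernel_measurable[OF assms] in \<open>simp add: split_beta'\<close>)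
qed

text \<open>The kernel bound does not depend on z, so it can be integrated over E directly. Bounds
  at every point, rather than almost everywhere, pass through iteration without exceptional
  sets.\<close>

lemma norm_sweep_le:
  assumes k: "integrable disc_measure (\<lambda>w. indicator E w * kernel_bound w)"
    and g: "\<And>w. cmod (g w) \<le> B"
  shows "cmod (sweep E g z) \<le> B * (LINT w|disc_measure. indicator E w * kernel_bound w)"
proof -
  have "B \<ge> 0" using order_trans[OF norm_ge_zero g] .
  have "cmod (sweep E g z) \<le> (LINT w|disc_measure. cmod (indicator E w *\<^sub>R (g w * repro_kernel z w)))"
    unfolding sweep_def by (rule integral_norm_bound)
  also have "\<dots> \<le> (LINT w|disc_measure. B * (indicator E w * kernel_bound w))"
  proof (rule integral_mono')
    fix w assume "w \<in> space disc_measure"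
    then have "w \<in> \<Delta>" by simp
    then have "cmod (g w) * cmod (repro_kernel z w) \<le> B * kernel_bound w"
      using g norm_repro_kernel_le \<open>B \<ge> 0\<close> by (intro mult_mono) auto
    then show "cmod (indicator E w *\<^sub>R (g w * repro_kernel z w)) \<le> B * (indicator E w * kernel_bound w)"
      by (simp add: norm_mult indicator_def)
    show "0 \<le> B * (indicator E w * kernel_bound w)"
      using \<open>B \<ge> 0\<close> kernel_bound_nonneg by simp
  qed (use k in simp)
  also have "\<dots> = B * (LINT w|disc_measure. indicator E w * kernel_bound w)"
    by simp
  finally show ?thesis .
qed

text \<open>Fubini, then the reproducing formula for each w; the majorant is the product of
  |\<phi>(z)| with B times the kernel bound on E. In the quotient, \<open>sweep E g\<close> thus
  represents the restriction of g to E.\<close>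

lemma integral_sweep:
  assumes E: "E \<in> sets borel" "E \<subseteq> \<Delta>" and g: "g \<in> borel_measurable disc_measure"
    and k: "integrable disc_measure (\<lambda>w. indicator E w * kernel_bound w)"
    and bd: "\<And>w. cmod (g w) \<le> B" and \<phi>: "\<phi> \<in> quad_diffs"
  shows "(LINT z|disc_measure. sweep E g z * \<phi> z) = (LINT w|disc_measure. indicator E w *\<^sub>R (g w * \<phi> w))"
proof -
  interpret D: finite_measure disc_measure by (rule finite_measure_disc)
  interpret P: pair_sigma_finite disc_measure disc_measure ..
  let ?f = "\<lambda>z w. indicator E w *\<^sub>R (g w * repro_kernel z w) * \<phi> z"
  have "B \<ge> 0" using order_trans[OF norm_ge_zero bd] .
  have int: "integrable (disc_measure \<Otimes>\<^sub>M disc_measure) (\<lambda>(z, w). ?f z w)"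
    unfolding split_beta'
  proof (rule Bochner_Integration.integrable_bound)
    show "integrable (disc_measure \<Otimes>\<^sub>M disc_measure)
        (\<lambda>p. cmod (\<phi> (fst p)) * (B * (indicator E (snd p) * kernel_bound (snd p))))"
      by (rule P.integrable_times) (use \<phi> k in \<open>auto simp: quad_diffs_def\<close>)
    show "(\<lambda>p. ?f (fst p) (snd p)) \<in> borel_measurable (disc_measure \<Otimes>\<^sub>M disc_measure)"
      by (intro borel_measurable_times sweep_kernel_measurable[OF E g]
          measurable_compose[OF measurable_fst quad_diffs_measurable[OF \<phi>]])
    show "AE p in disc_measure \<Otimes>\<^sub>M disc_measure. cmod (?f (fst p) (snd p))
        \<le> norm (cmod (\<phi> (fst p)) * (B * (indicator E (snd p) * kernel_bound (snd p))))"
    proof (rule AE_I2)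
      fix p assume "p \<in> space (disc_measure \<Otimes>\<^sub>M disc_measure)"
      then have "snd p \<in> \<Delta>" by (auto simp: space_pair_measure)
      then have "cmod (g (snd p)) * cmod (repro_kernel (fst p) (snd p)) \<le> B * kernel_bound (snd p)"
        using bd norm_repro_kernel_le \<open>B \<ge> 0\<close> by (intro mult_mono) auto
      then have "cmod (\<phi> (fst p)) * (indicator E (snd p) * (cmod (g (snd p)) * cmod (repro_kernel (fst p) (snd p))))
        \<le> cmod (\<phi> (fst p)) * (indicator E (snd p) * (B * kernel_bound (snd p)))"
        by (intro mult_left_mono) auto
      then show "cmod (?f (fst p) (snd p))
        \<le> norm (cmod (\<phi> (fst p)) * (B * (indicator E (snd p) * kernel_bound (snd p))))"
        using \<open>B \<ge> 0\<close> kernel_bound_nonneg[of "snd p"] by (simp add: norm_mult mult_ac abs_mult)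
    qed
  qed
  have hol: "\<phi> holomorphic_on \<Delta>" using \<phi> by (simp add: quad_diffs_def)
  have "(LINT z|disc_measure. sweep E g z * \<phi> z) = (LINT z|disc_measure. LINT w|disc_measure. ?f z w)"
    unfolding sweep_def by (simp only: integral_mult_left_zero)
  also have "\<dots> = (LINT w|disc_measure. LINT z|disc_measure. ?f z w)"
    by (rule P.Fubini_integral[OF int, symmetric])
  also have "\<dots> = (LINT w|disc_measure. indicator E w *\<^sub>R (g w * \<phi> w))"
  proof (rule Bochner_Integration.integral_cong[OF refl])
    fix w assume "w \<in> space disc_measure"
    then have w: "w \<in> \<Delta>" by simp
    have "(LINT z|disc_measure. ?f z w) = (LINT z|disc_measure. (indicator E w *\<^sub>R g w) * (repro_kernel z w * \<phi> z))"
      by (simp add: mult_ac)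
    also have "\<dots> = (indicator E w *\<^sub>R g w) * \<phi> w"
      unfolding integral_mult_right_zero repro_kernel_reproduces[OF hol w] ..
    finally show "(LINT z|disc_measure. ?f z w) = indicator E w *\<^sub>R (g w * \<phi> w)" by simp
  qed
  finally show ?thesis .
qed

text \<open>If \<open>T\<close> sweeps the part of a differential on \<open>E\<close> over the whole disc, then the
  restriction of the Neumann series of \<open>T\<close> to the complement of \<open>E\<close> is equivalent to \<open>g\<close>,
  since \<open>\<integral>(1 - 1\<^sub>E) T\<^sup>k g \<phi> = \<integral>(T\<^sup>k g - T\<^sup>k\<^sup>+\<^sup>1 g) \<phi>\<close> telescopes.\<close>

lemma exists_swept_differential:
  assumes E: "E \<in> sets borel" "E \<subseteq> \<Delta>" and g: "g \<in> borel_measurable disc_measure"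
    and k: "integrable disc_measure (\<lambda>w. indicator E w * kernel_bound w)"
    and e: "(LINT w|disc_measure. indicator E w * kernel_bound w) \<le> e" "e < 1"
    and bd: "\<And>w. cmod (g w) \<le> B"
  obtains \<nu> where "\<nu> \<in> borel_measurable disc_measure" "\<And>z. z \<in> E \<Longrightarrow> \<nu> z = 0"
    "\<And>z. cmod (\<nu> z) \<le> B / (1 - e)"
    "\<And>\<phi>. \<phi> \<in> quad_diffs \<Longrightarrow> (LINT z|disc_measure. \<nu> z * \<phi> z) = (LINT z|disc_measure. g z * \<phi> z)"
proof
  have "B \<ge> 0" using order_trans[OF norm_ge_zero bd] .
  have "e \<ge> 0" using e(1) by (rule order_trans[rotated]) (simp add: kernel_bound_nonneg integral_nonneg_AE)
  \<comment> \<open>\<open>T 0\<close> is g itself, and \<open>S k\<close> is what the k-th iterate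
    leaves outside E.\<close>
  define T where "T k = (sweep E ^^ k) g" for k
  define S where "S k z = indicator (- E) z *\<^sub>R T k z" for k z
  define \<nu> where "\<nu> z = (\<Sum>k. S k z)" for z
  \<comment> \<open>Each sweep multiplies the bound by at most e, whence the geometric majorant with
    sum B / (1 - e).\<close>
  have T_bd: "cmod (T k z) \<le> B * e ^ k" for k z
  proof (induction k arbitrary: z)
    case (Suc n)
    have "cmod (T (Suc n) z) \<le> B * e ^ n * (LINT w|disc_measure. indicator E w * kernel_bound w)"
      unfolding T_def funpow.simps o_apply using Suc by (intro norm_sweep_le k) (simp add: T_def)
    also have "\<dots> \<le> B * e ^ n * e"
      using e(1) \<open>B \<ge> 0\<close> \<open>e \<ge> 0\<close> by (intro mult_left_mono) auto
    finally show ?case by (simp add: mult_ac)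
  qed (simp add: T_def bd)
  have T_meas [measurable]: "T k \<in> borel_measurable disc_measure" for k
    by (induction k) (simp_all add: T_def g sweep_measurable[OF E])
  have "(indicator (- E) :: complex \<Rightarrow> real) \<in> borel_measurable disc_measure"
    using E by (intro measurable_compose[OF ident_disc_measurable]) simp
  then have S_meas [measurable]: "S k \<in> borel_measurable disc_measure" for k
    unfolding S_def[abs_def] by (intro borel_measurable_scaleR T_meas)
  have S_bd: "cmod (S k z) \<le> B * e ^ k" for k z
    using T_bd[of k z] \<open>B \<ge> 0\<close> \<open>e \<ge> 0\<close> by (auto simp: S_def indicator_def)
  have geo: "summable (\<lambda>k. B * e ^ k)" using \<open>e \<ge> 0\<close> e(2) by (intro summable_mult) simp
  show "\<nu> \<in> borel_measurable disc_measure"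
    unfolding \<nu>_def[abs_def] by measurable
  show "\<nu> z = 0" if "z \<in> E" for z
    using that by (simp add: \<nu>_def S_def)
  show "cmod (\<nu> z) \<le> B / (1 - e)" for z
  proof -
    have "cmod (\<nu> z) \<le> (\<Sum>k. B * e ^ k)"
      unfolding \<nu>_def by (rule norm_suminf_le[OF S_bd geo])
    also have "\<dots> = B * (1 / (1 - e))"
      using \<open>e \<ge> 0\<close> e(2) by (subst suminf_mult) (simp_all add: suminf_geometric)
    finally show ?thesis by simp
  qed
  show "(LINT z|disc_measure. \<nu> z * \<phi> z) = (LINT z|disc_measure. g z * \<phi> z)" if \<phi>: "\<phi> \<in> quad_diffs" for \<phi>
  proof -
    define a where "a k = (LINT z|disc_measure. T k z * \<phi> z)" for k
    have T_int: "integrable disc_measure (\<lambda>z. T k z * \<phi> z)" for k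
      by (rule integrable_mult_quad_diff[OF T_meas \<phi> AE_I2[OF T_bd]])
    have S_int: "integrable disc_measure (\<lambda>z. S k z * \<phi> z)" for k
      by (rule integrable_mult_quad_diff[OF S_meas \<phi> AE_I2[OF S_bd]])
    have \<phi>_int: "integrable disc_measure (\<lambda>z. cmod (\<phi> z))" using \<phi> by (simp add: quad_diffs_def)
    \<comment> \<open>By \<open>integral_sweep\<close>, the part of \<open>T k\<close> on E pairs
      with \<phi> like \<open>T (Suc k)\<close>.\<close>
    have S_a: "(LINT z|disc_measure. S k z * \<phi> z) = a k - a (Suc k)" for k
    proof -
      have "a (Suc k) = (LINT z|disc_measure. sweep E (T k) z * \<phi> z)"
        by (simp add: a_def T_def)
      also have "\<dots> = (LINT z|disc_measure. indicator E z *\<^sub>R (T k z * \<phi> z))"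
        by (rule integral_sweep[OF E T_meas k T_bd \<phi>])
      finally have "a k - a (Suc k) = (LINT z|disc_measure. T k z * \<phi> z - indicator E z *\<^sub>R (T k z * \<phi> z))"
        unfolding a_def using T_int borel_disc_measurable[OF E]
        by (simp add: Bochner_Integration.integral_diff integrable_mult_indicator)
      also have "\<dots> = (LINT z|disc_measure. S k z * \<phi> z)"
        by (intro Bochner_Integration.integral_cong) (auto simp: S_def indicator_def)
      finally show ?thesis by simp
    qed
    \<comment> \<open>Geometric bounds, first for the integrals and then pointwise, justify
      integrating the series term by term.\<close>
    have "(LINT z|disc_measure. cmod (S k z * \<phi> z)) \<le> (LINT z|disc_measure. B * e ^ k * cmod (\<phi> z))" for k
      using S_bd \<phi>_int \<open>B \<ge> 0\<close> \<open>e \<ge> 0\<close>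
      by (intro integral_mono') (auto simp: norm_mult intro: mult_right_mono)
    then have "(LINT z|disc_measure. cmod (S k z * \<phi> z)) \<le> B * e ^ k * (LINT z|disc_measure. cmod (\<phi> z))" for k
      by simp
    then have sum1: "summable (\<lambda>k. LINT z|disc_measure. cmod (S k z * \<phi> z))"
      by (intro summable_comparison_test'[OF summable_mult2[OF geo], of 0]) simp
    have sum2: "summable (\<lambda>k. cmod (S k z * \<phi> z))" for z
      using S_bd by (intro summable_comparison_test'[OF summable_mult2[OF geo, of "cmod (\<phi> z)"], of 0])
        (simp add: norm_mult mult_right_mono)
    have "(\<lambda>k. LINT z|disc_measure. S k z * \<phi> z) sums (LINT z|disc_measure. (\<Sum>k. S k z * \<phi> z))"
      by (rule sums_integral[OF S_int _ sum1]) (use sum2 in simp)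
    moreover have "(\<Sum>k. S k z * \<phi> z) = \<nu> z * \<phi> z" for z
      unfolding \<nu>_def by (rule suminf_mult2[symmetric]) (rule summable_comparison_test'[OF geo, of 0], rule S_bd)
    ultimately have 1: "(\<lambda>k. a k - a (Suc k)) sums (LINT z|disc_measure. \<nu> z * \<phi> z)"
      by (simp add: S_a)
    \<comment> \<open>Since the pairings tend to 0, the telescoped sum is \<open>a 0\<close>, the
      pairing of g.\<close>
    have "a \<longlonglongrightarrow> 0"
    proof (rule Lim_null_comparison)
      show "\<forall>\<^sub>F k in sequentially. cmod (a k) \<le> B * e ^ k * (LINT z|disc_measure. cmod (\<phi> z))"
      proof (intro always_eventually allI)
        fix k
        have "cmod (a k) \<le> (LINT z|disc_measure. cmod (T k z * \<phi> z))"
          unfolding a_def by (rule integral_norm_bound)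
        also have "\<dots> \<le> (LINT z|disc_measure. B * e ^ k * cmod (\<phi> z))"
          using T_bd \<phi>_int \<open>B \<ge> 0\<close> \<open>e \<ge> 0\<close>
          by (intro integral_mono') (auto simp: norm_mult intro: mult_right_mono)
        finally show "cmod (a k) \<le> B * e ^ k * (LINT z|disc_measure. cmod (\<phi> z))" by simp
      qed
      have "(\<lambda>k. B * e ^ k) \<longlonglongrightarrow> 0" by (rule summable_LIMSEQ_zero[OF geo])
      then show "(\<lambda>k. B * e ^ k * (LINT z|disc_measure. cmod (\<phi> z))) \<longlonglongrightarrow> 0"
        by (rule tendsto_mult_left_zero)
    qed
    from telescope_sums'[OF this] 1 have "(LINT z|disc_measure. \<nu> z * \<phi> z) = a 0"
      by (metis diff_zero sums_unique2)
    then show ?thesis by (simp add: a_def T_def)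
  qed
qed

section \<open>Dense open sets of small kernel weight\<close>

text \<open>On the disc pi (1 - |w|)^2 \<le> 4 \<le> 32, so the weight is at least 1. This will show
  that a set of small weight cannot fill a given ball.\<close>

lemma emeasure_kernel_le:
  assumes "A \<in> sets borel" "A \<subseteq> \<Delta>"
  shows "emeasure disc_measure A \<le> (\<integral>\<^sup>+w. ennreal (indicator A w * kernel_bound w) \<partial>disc_measure)"
proof -
  have "indicator A w \<le> ennreal (indicator A w * kernel_bound w)" if "w \<in> \<Delta>" for w
  proof -
    have "pi * (1 - cmod w)\<^sup>2 \<le> 4 * 1"
      using that pi_less_4 by (intro mult_mono power_le_one) auto
    moreover have "0 < pi * (1 - cmod w)\<^sup>2" using that by simp
    ultimately have "1 \<le> kernel_bound w" by (simp add: kernel_bound_def le_divide_eq)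
    then show ?thesis by (simp add: indicator_def)
  qed
  then have "(\<integral>\<^sup>+w. indicator A w \<partial>disc_measure) \<le> (\<integral>\<^sup>+w. ennreal (indicator A w * kernel_bound w) \<partial>disc_measure)"
    by (intro nn_integral_mono) simp
  then show ?thesis using borel_disc_measurable[OF assms] by simp
qed

lemma indicator_kernel_measurable:
  assumes [measurable]: "A \<in> sets borel"
  shows "(\<lambda>w. indicator A w * kernel_bound w) \<in> borel_measurable disc_measure"
proof -
  have "(\<lambda>w. indicator A w * kernel_bound w) \<in> borel_measurable borel"
    unfolding kernel_bound_def by measurable
  then show ?thesis by (rule measurable_compose[OF ident_disc_measurable])
qed

text \<open>The weight blows up only at the unit circle. On a ball about z of radius at most R, half
  the distance from z to that circle, it is at most C, and the integral is at most C pi r^2.\<close>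

lemma kernel_bound_small_ball:
  assumes z: "z \<in> \<Delta>" and "\<epsilon> > 0"
  obtains r where "r > 0" "ball z r \<subseteq> \<Delta>"
    "(\<integral>\<^sup>+w. ennreal (indicator (ball z r) w * kernel_bound w) \<partial>disc_measure) \<le> ennreal \<epsilon>"
proof -
  define R where "R = (1 - cmod z) / 2"
  define C where "C = 32 / (pi * R\<^sup>2)"
  \<comment> \<open>As r \<le> R < 1 gives r^2 \<le> r, a bound linear in \<epsilon> suffices and no
    square root is needed.\<close>
  define r where "r = min R (\<epsilon> / (C * pi))"
  have R: "0 < R" "R < 1" "cmod z + 2 * R = 1" using z norm_ge_zero[of z] by (auto simp: R_def field_simps simp del: norm_ge_zero)
  have C: "C > 0" using R by (simp add: C_def)
  have r: "0 < r" "r \<le> R" "r \<le> \<epsilon> / (C * pi)" using R C assms(2) by (auto simp: r_def)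
  have norm_le: "cmod w \<le> 1 - R" if "w \<in> ball z r" for w
    using that r R norm_triangle_sub[of w z] by (simp add: dist_norm norm_minus_commute)
  then have sub: "ball z r \<subseteq> \<Delta>" using R by force
  have "kernel_bound w \<le> C" if "w \<in> ball z r" for w
  proof -
    have "R\<^sup>2 \<le> (1 - cmod w)\<^sup>2" using norm_le[OF that] R by (intro power_mono) auto
    then show ?thesis using R unfolding kernel_bound_def C_def
      by (intro divide_left_mono mult_left_mono mult_pos_pos) (auto intro: less_le_trans[of 0 "R\<^sup>2"])
  qed
  then have "(\<integral>\<^sup>+w. ennreal (indicator (ball z r) w * kernel_bound w) \<partial>disc_measure)
      \<le> (\<integral>\<^sup>+w. ennreal C * indicator (ball z r) w \<partial>disc_measure)"
    by (intro nn_integral_mono) (auto simp: indicator_def intro: ennreal_leI)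
  also have "\<dots> = ennreal C * emeasure disc_measure (ball z r)"
    using borel_disc_measurable[OF _ sub] by (simp add: nn_integral_cmult_indicator)
  also have "emeasure disc_measure (ball z r) = ennreal (pi * r\<^sup>2)"
    using sub r by (simp add: emeasure_restrict_space emeasure_ball unit_ball_vol_2)
  also have "ennreal C * ennreal (pi * r\<^sup>2) = ennreal (C * pi * r\<^sup>2)"
    using C by (simp add: ennreal_mult[symmetric] mult.assoc)
  also have "\<dots> \<le> ennreal \<epsilon>"
  proof (rule ennreal_leI)
    have "r\<^sup>2 \<le> r" using r R by (simp add: power2_eq_square mult_left_le)
    then have "r\<^sup>2 \<le> \<epsilon> / (C * pi)" using r by simp
    then show "C * pi * r\<^sup>2 \<le> \<epsilon>" using C by (simp add: pos_le_divide_eq mult.commute)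
  qed
  finally show ?thesis using that r sub by blast
qed

text \<open>Take balls around an enumerated countable dense subset of the disc, the n-th of weight
  at most \<epsilon> / 2^(n+1); these bounds sum to \<epsilon>.\<close>

lemma exists_small_dense_open:
  assumes "\<epsilon> > 0"
  obtains E where "open E" "E \<subseteq> \<Delta>" "\<And>G. open G \<Longrightarrow> G \<noteq> {} \<Longrightarrow> G \<subseteq> \<Delta> \<Longrightarrow> G \<inter> E \<noteq> {}"
    "(\<integral>\<^sup>+w. ennreal (indicator E w * kernel_bound w) \<partial>disc_measure) \<le> ennreal \<epsilon>"
proof -
  obtain D :: "complex set" where D: "countable D" "\<And>X. open X \<Longrightarrow> X \<noteq> {} \<Longrightarrow> \<exists>d\<in>D. d \<in> X"
    using countable_dense_setE by blast
  define d where "d = from_nat_into (D \<inter> \<Delta>)"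
  have ne: "D \<inter> \<Delta> \<noteq> {}" using D(2)[of \<Delta>] by auto
  have range_d: "range d = D \<inter> \<Delta>"
    unfolding d_def using D(1) ne by (intro range_from_nat_into) auto
  have "\<exists>r>0. ball (d n) r \<subseteq> \<Delta> \<and>
      (\<integral>\<^sup>+w. ennreal (indicator (ball (d n) r) w * kernel_bound w) \<partial>disc_measure) \<le> ennreal (\<epsilon> * (1/2)^Suc n)" for n
  proof -
    have "d n \<in> \<Delta>" using range_d by blast
    from kernel_bound_small_ball[OF this, of "\<epsilon> * (1/2)^Suc n"] assms show ?thesis by (metis mult_pos_pos half_gt_zero_iff zero_less_one zero_less_power)
  qed
  then obtain r where r: "\<And>n. r n > 0" "\<And>n. ball (d n) (r n) \<subseteq> \<Delta>"
    and r_int: "\<And>n. (\<integral>\<^sup>+w. ennreal (indicator (ball (d n) (r n)) w * kernel_bound w) \<partial>disc_measure) \<le> ennreal (\<epsilon> * (1/2)^Suc n)"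
    by metis
  define E where "E = (\<Union>n. ball (d n) (r n))"
  show ?thesis
  proof
    show "open E" "E \<subseteq> \<Delta>" using r by (auto simp: E_def)
    show "G \<inter> E \<noteq> {}" if G: "open G" "G \<noteq> {}" "G \<subseteq> \<Delta>" for G
    proof -
      obtain x where "x \<in> D" "x \<in> G" using D(2)[OF G(1,2)] by blast
      then obtain n where "x = d n" using range_d G(3) by blast
      then have "x \<in> ball (d n) (r n)" using r(1)[of n] by simp
      then have "x \<in> E" unfolding E_def by blast
      then show ?thesis using \<open>x \<in> G\<close> by blast
    qed
    \<comment> \<open>Countable subadditivity, pointwise: a point of E lies in some ball, and the
      term of that ball alone is dominated by the series.\<close>
    have "(\<integral>\<^sup>+w. ennreal (indicator E w * kernel_bound w) \<partial>disc_measure)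
        \<le> (\<integral>\<^sup>+w. (\<Sum>n. ennreal (indicator (ball (d n) (r n)) w * kernel_bound w)) \<partial>disc_measure)"
    proof (rule nn_integral_mono)
      fix w
      show "ennreal (indicator E w * kernel_bound w) \<le> (\<Sum>n. ennreal (indicator (ball (d n) (r n)) w * kernel_bound w))"
      proof (cases "w \<in> E")
        case True
        then obtain n where "w \<in> ball (d n) (r n)" by (auto simp: E_def)
        then have "ennreal (indicator E w * kernel_bound w) = (\<Sum>m\<in>{n}. ennreal (indicator (ball (d m) (r m)) w * kernel_bound w))"
          using True by simp
        also have "\<dots> \<le> (\<Sum>n. ennreal (indicator (ball (d n) (r n)) w * kernel_bound w))"
          by (rule sum_le_suminf) auto
        finally show ?thesis .
      qed simp
    qed
    also have "\<dots> = (\<Sum>n. \<integral>\<^sup>+w. ennreal (indicator (ball (d n) (r n)) w * kernel_bound w) \<partial>disc_measure)"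
      by (intro nn_integral_suminf measurable_compose[OF indicator_kernel_measurable measurable_ennreal]) simp
    also have "\<dots> \<le> (\<Sum>n. ennreal (\<epsilon> * (1/2)^Suc n))"
      by (intro suminf_le r_int) auto
    also have "\<dots> = ennreal (\<epsilon> * 1)"
      using assms by (intro suminf_ennreal_eq sums_mult power_half_series) simp
    finally show "(\<integral>\<^sup>+w. ennreal (indicator E w * kernel_bound w) \<partial>disc_measure) \<le> ennreal \<epsilon>" by simp
  qed
qed

section \<open>Essential bounds, equivalence, and a criterion for weak non-decreasability\<close>

lemma AE_bel_norm:
  assumes "f \<in> Bel"
  shows "AE z in disc_measure. cmod (f z) \<le> bel_norm f"
proof -
  have "AE z in disc_measure. ereal (cmod (f z)) \<le> bel_esssup f"
    unfolding bel_esssup_def by (rule esssup_AE)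
  then show ?thesis
  proof eventually_elim
    case (elim z)
    moreover have "bel_esssup f < \<infinity>" using assms by (simp add: Bel_def)
    ultimately show ?case unfolding bel_norm_def by (cases "bel_esssup f") auto
  qed
qed

lemma Bel_normI:
  assumes f: "f \<in> borel_measurable disc_measure" and B: "AE z in disc_measure. cmod (f z) \<le> B" "B \<ge> 0"
  shows "f \<in> Bel" "bel_norm f \<le> B"
proof -
  have "bel_esssup f \<le> ereal B"
    unfolding bel_esssup_def using B(1) f by (intro esssup_I) auto
  then show "f \<in> Bel" "bel_norm f \<le> B"
    using f B(2) by (cases "bel_esssup f"; auto simp: Bel_def bel_norm_def)+
qed

text \<open>A negative value would make the almost-everywhere bound fail at every point, although
  the disc has positive area. It bounds the infimum in \<open>Z_norm\<close> from below.\<close>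

lemma bel_norm_nonneg:
  assumes "f \<in> Bel"
  shows "0 \<le> bel_norm f"
proof (rule ccontr)
  assume "\<not> 0 \<le> bel_norm f"
  then have less: "\<not> cmod (f z) \<le> bel_norm f" for z using norm_ge_zero[of "f z"] by linarith
  from AE_bel_norm[OF assms] have "AE z in disc_measure. False" by (simp add: less)
  then have "emeasure disc_measure (space disc_measure) = 0"
    by (simp only: eventually_False ae_filter_eq_bot_iff)
  then show False by (simp add: emeasure_restrict_space emeasure_ball unit_ball_vol_2)
qed

lemma Bel_measurable: "f \<in> Bel \<Longrightarrow> f \<in> borel_measurable disc_measure"
  by (simp add: Bel_def)

lemma integrable_Bel_quad_diff:
  "f \<in> Bel \<Longrightarrow> \<phi> \<in> quad_diffs \<Longrightarrow> integrable disc_measure (\<lambda>z. f z * \<phi> z)"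
  by (rule integrable_mult_quad_diff[OF Bel_measurable _ AE_bel_norm])

text \<open>Splitting the integral of the difference relies on both products being integrable, which
  essential boundedness provides. Equality of pairings is easier to chain.\<close>

lemma Z_rel_iff:
  "(\<mu>, \<nu>) \<in> Z_rel \<longleftrightarrow> \<mu> \<in> Bel \<and> \<nu> \<in> Bel \<and>
     (\<forall>\<phi>\<in>quad_diffs. (LINT z|disc_measure. \<mu> z * \<phi> z) = (LINT z|disc_measure. \<nu> z * \<phi> z))"
  by (auto simp: Z_rel_def left_diff_distrib integrable_Bel_quad_diff Bochner_Integration.integral_diff)

lemma AE_disc_measure_not_in:
  assumes "AE z in disc_measure. z \<notin> A" "A \<in> sets borel" "A \<subseteq> \<Delta>"
  shows "emeasure disc_measure A = 0"
  using assms borel_disc_measurable[OF assms(2,3)] by (metis AE_iff_null_sets null_setsD1)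

text \<open>Condition (B) would require |\<eta>| \<le> -\<delta> almost everywhere on G \<inter> E,
  making a nonempty open set negligible.\<close>

lemma weakly_non_decreasableI:
  assumes E: "open E" "E \<subseteq> \<Delta>" "\<And>G. open G \<Longrightarrow> G \<noteq> {} \<Longrightarrow> G \<subseteq> \<Delta> \<Longrightarrow> G \<inter> E \<noteq> {}"
    and \<nu>: "\<And>z. z \<in> E \<Longrightarrow> \<nu> z = 0"
  shows "weakly_non_decreasable \<nu>"
  unfolding weakly_non_decreasable_def strongly_decreasable_def
proof (rule notI, elim bexE conjE exE)
  fix \<eta> :: "complex \<Rightarrow> complex" and G and \<delta> :: real
  assume G: "open G" "G \<noteq> {}" "G \<subseteq> \<Delta>" and "\<delta> > 0"
    and AE: "AE z in lebesgue_on G. cmod (\<eta> z) \<le> cmod (\<nu> z) - \<delta>"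
  have "AE z in lebesgue_on G. z \<notin> E"
    using AE
  proof eventually_elim
    case (elim z)
    have "\<not> cmod (\<eta> z) \<le> 0 - \<delta>" using norm_ge_zero[of "\<eta> z"] \<open>\<delta> > 0\<close> by linarith
    then show ?case using elim \<nu> by auto
  qed
  then have "AE z in lebesgue. z \<notin> G \<inter> E"
    using G by (subst (asm) AE_restrict_space_iff) auto
  then have "negligible (G \<inter> E)"
    by (simp add: negligible_iff_null_sets AE_iff_null_sets E G)
  then show False
    using open_not_negligible[of "G \<inter> E"] E G by blast
qed

section \<open>Representatives told apart by constants on a set of positive measure\<close>

theorem theorem2:
  fixes \<mu> :: "complex \<Rightarrow> complex" and lam :: real
  assumes "\<mu> \<in> Bel"
    and "lam > Z_norm (Z_class \<mu>)"
  shows "infinite ({\<nu> \<in> Z_class \<mu>. weakly_non_decreasable \<nu> \<and> bel_norm \<nu> \<le> lam} // ae_rel)"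
proof -
  \<comment> \<open>The infimum is a real one, so extracting a representative of norm below lam
    takes a lower bound and a nonempty class.\<close>
  have "bdd_below (bel_norm ` Z_class \<mu>)"
    using bel_norm_nonneg by (intro bdd_belowI2[of _ 0]) (auto simp: Z_class_def Z_rel_def)
  moreover have "\<mu> \<in> Z_class \<mu>" using assms(1) by (simp add: Z_class_def Z_rel_def)
  ultimately obtain \<mu>' where \<mu>': "(\<mu>, \<mu>') \<in> Z_rel" "bel_norm \<mu>' < lam"
    using assms(2) unfolding Z_norm_def by (subst (asm) cINF_less_iff) (auto simp: Z_class_def)
  have \<mu>'_Bel: "\<mu>' \<in> Bel" using \<mu>'(1) by (simp add: Z_rel_def)
  define M where "M = bel_norm \<mu>'"
  have M: "0 \<le> M" "M < lam" using bel_norm_nonneg[OF \<mu>'_Bel] \<mu>'(2) by (simp_all add: M_def)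
  \<comment> \<open>Distinct positive constants, at most half the gap: subtracting one from a
    function bounded by M gives the bound (lam + M) / 2.\<close>
  define t where "t n = (lam - M) / (2 * real (Suc n))" for n
  have t: "0 < t n" "t n \<le> (lam - M) / 2" for n
    using M unfolding t_def by (simp, intro divide_left_mono) auto
  have t_inj: "n = m" if "t n = t m" for n m
    using that M by (simp add: t_def)
  \<comment> \<open>Chosen so that the Neumann factor 1 / (1 - e) raises (lam + M) / 2 exactly to
    lam.\<close>
  define e where "e = 1 - (lam + M) / (2 * lam)"
  have e: "0 < e" "e < 1" "((lam + M) / 2) / (1 - e) = lam"
    using M by (auto simp: e_def field_simps)
  let ?K = "\<lambda>A. \<integral>\<^sup>+w. ennreal (indicator A w * kernel_bound w) \<partial>disc_measure"
  obtain r where r: "r > 0" "ball (0::complex) r \<subseteq> \<Delta>" "?K (ball 0 r) \<le> ennreal (e / 2)"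
    using kernel_bound_small_ball[of 0 "e / 2"] e by auto
  define c where "c = pi * r\<^sup>2"
  have c: "c > 0" "emeasure disc_measure (ball 0 r) = ennreal c"
    using r by (simp_all add: c_def emeasure_restrict_space emeasure_ball unit_ball_vol_2)
  \<comment> \<open>The budget e / 2 adds up with that of the ball to the contraction factor e; the
    budget c / 2 keeps E from filling the ball, whose area is c.\<close>
  obtain E where E: "open E" "E \<subseteq> \<Delta>" "\<And>G. open G \<Longrightarrow> G \<noteq> {} \<Longrightarrow> G \<subseteq> \<Delta> \<Longrightarrow> G \<inter> E \<noteq> {}"
    "?K E \<le> ennreal (min (e / 2) (c / 2))"
    using exists_small_dense_open[of "min (e / 2) (c / 2)"] e c by auto
  define F where "F = ball 0 r - E"
  have F: "F \<in> sets borel" "F \<subseteq> \<Delta>" "F \<inter> E = {}" "F \<subseteq> E \<union> ball 0 r"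
    using E r by (auto simp: F_def)
  have F_pos: "emeasure disc_measure F \<noteq> 0"
  proof
    assume "emeasure disc_measure F = 0"
    have "emeasure disc_measure (ball 0 r) \<le> emeasure disc_measure (F \<union> E)"
      using F E by (intro emeasure_mono) (auto simp: F_def intro!: borel_disc_measurable)
    also have "\<dots> \<le> emeasure disc_measure F + emeasure disc_measure E"
      using F E by (intro emeasure_subadditive borel_disc_measurable) auto
    also have "\<dots> \<le> ?K E"
      using \<open>emeasure disc_measure F = 0\<close> emeasure_kernel_le[of E] E by simp
    also have "\<dots> \<le> ennreal (c / 2)"
      by (rule order_trans[OF E(4) ennreal_leI]) simp
    finally show False using c by (simp add: ennreal_le_iff)
  qed
  \<comment> \<open>The swept region contains F as well as E, so the swept differential vanishes on
    F and a constant can be placed there.\<close>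
  let ?A = "E \<union> ball 0 r"
  have A: "?A \<in> sets borel" "?A \<subseteq> \<Delta>" using E r by auto
  have "?K ?A \<le> (\<integral>\<^sup>+w. ennreal (indicator E w * kernel_bound w) + ennreal (indicator (ball 0 r) w * kernel_bound w) \<partial>disc_measure)"
    by (intro nn_integral_mono) (auto simp: indicator_def)
  also have "\<dots> = ?K E + ?K (ball 0 r)"
    using E by (intro nn_integral_add measurable_compose[OF indicator_kernel_measurable measurable_ennreal]) auto
  also have "\<dots> \<le> ennreal (e / 2) + ennreal (e / 2)"
    by (intro add_mono order_trans[OF E(4)] r(3) ennreal_leI) simp
  also have "\<dots> = ennreal e" using e by (simp add: ennreal_plus[symmetric] del: ennreal_plus)
  finally have KA: "?K ?A \<le> ennreal e" .
  have k_int: "integrable disc_measure (\<lambda>w. indicator ?A w * kernel_bound w)"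
    using KA indicator_kernel_measurable[OF A(1)] kernel_bound_nonneg
    by (intro integrableI_nonneg) (auto intro: le_less_trans)
  have k_le: "(LINT w|disc_measure. indicator ?A w * kernel_bound w) \<le> e"
    by (rule integral_real_bounded) (use KA e in auto)
  have F_meas: "(\<lambda>z. indicator F z *\<^sub>R complex_of_real s) \<in> borel_measurable disc_measure" for s
    using borel_disc_measurable[OF F(1,2)] by simp
  \<comment> \<open>A change on a null set makes the bound M hold everywhere, as
    \<open>exists_swept_differential\<close> requires.\<close>
  define h where "h z = (if cmod (\<mu>' z) \<le> M then \<mu>' z else 0)" for z
  have [measurable]: "\<mu>' \<in> borel_measurable disc_measure" by (rule Bel_measurable[OF \<mu>'_Bel])
  have h_meas: "h \<in> borel_measurable disc_measure" unfolding h_def[abs_def] by measurable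
  have h_bd: "cmod (h z) \<le> M" for z using M by (simp add: h_def)
  have h_AE: "AE z in disc_measure. h z = \<mu>' z"
    using AE_bel_norm[OF \<mu>'_Bel] by eventually_elim (simp add: h_def M_def)
  have "\<exists>\<xi>. (\<mu>, \<xi>) \<in> Z_rel \<and> weakly_non_decreasable \<xi> \<and> bel_norm \<xi> \<le> lam \<and> (\<forall>z\<in>F. \<xi> z = of_real (t n))" for n
  proof -
    \<comment> \<open>The constant is subtracted on F before sweeping and added back afterwards: the
      class stays that of \<mu>', while the final value on F is \<open>t n\<close>.\<close>
    define g where "g z = h z - indicator F z *\<^sub>R complex_of_real (t n)" for z
    have g_meas: "g \<in> borel_measurable disc_measure"
      unfolding g_def[abs_def] by (intro borel_measurable_diff h_meas F_meas)
    have g_bd: "cmod (g z) \<le> (lam + M) / 2" for z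
    proof -
      have "cmod (g z) \<le> cmod (h z) + cmod (indicator F z *\<^sub>R complex_of_real (t n))"
        unfolding g_def by (rule norm_triangle_ineq4)
      also have "\<dots> \<le> M + (lam - M) / 2"
        using h_bd[of z] t[of n] M by (intro add_mono) (auto simp: indicator_def)
      finally show ?thesis by (simp add: field_simps)
    qed
    obtain \<nu> where \<nu>: "\<nu> \<in> borel_measurable disc_measure" "\<And>z. z \<in> ?A \<Longrightarrow> \<nu> z = 0"
      "\<And>z. cmod (\<nu> z) \<le> (lam + M) / 2 / (1 - e)"
      "\<And>\<phi>. \<phi> \<in> quad_diffs \<Longrightarrow> (LINT z|disc_measure. \<nu> z * \<phi> z) = (LINT z|disc_measure. g z * \<phi> z)"
      using exists_swept_differential[OF A g_meas k_int k_le e(2) g_bd] by blast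
    define \<xi> where "\<xi> z = \<nu> z + indicator F z *\<^sub>R complex_of_real (t n)" for z
    have \<xi>_meas: "\<xi> \<in> borel_measurable disc_measure"
      unfolding \<xi>_def[abs_def] by (intro borel_measurable_add \<nu>(1) F_meas)
    have \<xi>_F: "\<xi> z = of_real (t n)" if "z \<in> F" for z
      using \<nu>(2)[of z] that F(4) by (auto simp: \<xi>_def)
    \<comment> \<open>On F only the constant survives and off F only \<nu>, so the two bounds do not
      add up.\<close>
    have \<xi>_bd: "cmod (\<xi> z) \<le> lam" for z
    proof (cases "z \<in> F")
      case True
      then show ?thesis using \<xi>_F[OF True] t[of n] M by (simp add: field_simps)
    next
      case False
      then show ?thesis using \<nu>(3)[of z] e(3) by (simp add: \<xi>_def)
    qed
    have \<xi>_Bel: "\<xi> \<in> Bel" "bel_norm \<xi> \<le> lam"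
      using Bel_normI[OF \<xi>_meas AE_I2[OF \<xi>_bd]] M by auto
    have "(LINT z|disc_measure. \<mu>' z * \<phi> z) = (LINT z|disc_measure. \<xi> z * \<phi> z)" if \<phi>: "\<phi> \<in> quad_diffs" for \<phi>
    proof -
      have F_int: "integrable disc_measure (\<lambda>z. (indicator F z *\<^sub>R complex_of_real (t n)) * \<phi> z)"
        by (rule integrable_mult_quad_diff[OF F_meas \<phi>, where B = "t n"])
           (use t[of n] in \<open>auto simp: indicator_def\<close>)
      have \<nu>_int: "integrable disc_measure (\<lambda>z. \<nu> z * \<phi> z)"
        by (rule integrable_mult_quad_diff[OF \<nu>(1) \<phi> AE_I2[OF \<nu>(3)]])
      have g_int: "integrable disc_measure (\<lambda>z. g z * \<phi> z)"
        by (rule integrable_mult_quad_diff[OF g_meas \<phi> AE_I2[OF g_bd]])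
      have "(LINT z|disc_measure. \<xi> z * \<phi> z) =
          (LINT z|disc_measure. \<nu> z * \<phi> z) + (LINT z|disc_measure. (indicator F z *\<^sub>R complex_of_real (t n)) * \<phi> z)"
        unfolding \<xi>_def distrib_right by (rule Bochner_Integration.integral_add[OF \<nu>_int F_int])
      also have "\<dots> = (LINT z|disc_measure. g z * \<phi> z + (indicator F z *\<^sub>R complex_of_real (t n)) * \<phi> z)"
        unfolding \<nu>(4)[OF \<phi>] by (rule Bochner_Integration.integral_add[OF g_int F_int, symmetric])
      also have "\<dots> = (LINT z|disc_measure. h z * \<phi> z)"
        unfolding distrib_right[symmetric] by (simp add: g_def)
      also have "\<dots> = (LINT z|disc_measure. \<mu>' z * \<phi> z)"
        using h_AE h_meas quad_diffs_measurable[OF \<phi>]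
        by (intro integral_cong_AE borel_measurable_times) auto
      finally show ?thesis by simp
    qed
    then have "(\<mu>, \<xi>) \<in> Z_rel"
      using \<mu>'(1) \<xi>_Bel(1) by (simp add: Z_rel_iff)
    \<comment> \<open>F is disjoint from E, so adding the constant preserves the zeros on E.\<close>
    moreover have "weakly_non_decreasable \<xi>"
      using E(1-3) by (rule weakly_non_decreasableI) (use \<nu>(2) F(3) in \<open>auto simp: \<xi>_def indicator_def\<close>)
    ultimately show ?thesis using \<xi>_Bel(2) \<xi>_F by blast
  qed
  then obtain \<xi> where \<xi>: "\<And>n. (\<mu>, \<xi> n) \<in> Z_rel" "\<And>n. weakly_non_decreasable (\<xi> n)"
    "\<And>n. bel_norm (\<xi> n) \<le> lam" "\<And>n z. z \<in> F \<Longrightarrow> \<xi> n z = of_real (t n)"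
    by metis
  \<comment> \<open>Almost-everywhere equality of two members would make F null, since their
    constants on F differ.\<close>
  have "inj (\<lambda>n. ae_rel `` {\<xi> n})"
  proof (rule injI)
    fix n m assume eq: "ae_rel `` {\<xi> n} = ae_rel `` {\<xi> m}"
    have "\<xi> m \<in> ae_rel `` {\<xi> m}" using \<xi>(1)[of m] by (simp add: ae_rel_def Z_rel_def)
    then have AE: "AE z in disc_measure. \<xi> n z = \<xi> m z"
      unfolding eq[symmetric] by (simp add: ae_rel_def)
    show "n = m"
    proof (rule ccontr)
      assume "n \<noteq> m"
      then have "t n \<noteq> t m" using t_inj by blast
      from AE have "AE z in disc_measure. z \<notin> F"
        by eventually_elim (use \<open>t n \<noteq> t m\<close> \<xi>(4) in force)
      then show False using AE_disc_measure_not_in[OF _ F(1,2)] F_pos by blast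
    qed
  qed
  then have "infinite (range (\<lambda>n. ae_rel `` {\<xi> n}))" by (rule range_inj_infinite)
  moreover have "range (\<lambda>n. ae_rel `` {\<xi> n}) \<subseteq>
      {\<nu> \<in> Z_class \<mu>. weakly_non_decreasable \<nu> \<and> bel_norm \<nu> \<le> lam} // ae_rel"
    using \<xi>(1-3) by (auto simp: Z_class_def intro!: quotientI)
  ultimately show ?thesis by (rule infinite_super[rotated])
qed

end
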